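(* Consider the dynamic competitive equilibrium described in the context, with active cutoffs $\{a_t\}_{t\ge 0}$, skill distributions $\{F_t\}_{t\ge0}$ and aggregate output $\{Y_t\}_{t\ge0}$. Then: (i) if $1-F_0\in \mathrm{RV}_{-1/\theta}$ with $\theta\in(0,1)$, then $$\lim_{t\to\infty}\frac{a_{t+1}}{a_t}=\lim_{t\to\infty}\frac{Y_{t+1}}{Y_t}=(N-I)^{\theta};$$ (ii) if $1-F_0\in \mathrm{RV}_{-\infty}$, then $$\lim_{t\to\infty}\frac{a_{t+1}}{a_t}=\lim_{t\to\infty}\frac{Y_{t+1}}{Y_t}=1.$$ (The common limit is denoted $1+g$.)
   Context: Parameters: $\rho>0$, $m>h>0$, $0<I<N$ with $N-I>1$. $F_0$ is a cumulative distribution function (CDF) with finite mean and a continuous, strictly positive density on its support $[x_0,\infty)$, where $x_0>\frac{\rho I}{h^N[(m/h)^I-1]}$. Economy: at date $t$ there is a unit mass of experts with skill CDF $F_t$ and a unit mass of novices; experts with skill at least $a_t$ are active, each hires $N-I$ novices, and each novice inherits her mentor's skill. The allocation part $\{a_t,F_t\}_{t\ge 0}$ of the dynamic competitive equilibrium is determined, given $F_0$, by the market-clearing condition $$1=(N-I)[1-F_t(a_t)]\qquad (t\ge 0)$$ and the law of motion $$F_{t+1}(q)=0 \text{ if } q\le a_t,\qquad F_{t+1}(q)=(N-I)[F_t(q)-F_t(a_t)]\text{ if } q>a_t .$$ (The price part of the equilibrium does not enter the quantities below.) Aggregate output is $Y_t=m^Ih^{N-I}\int_{a_t}^\infty q\,dF_t(q)$.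 Tail classes: $1-F_0\in\mathrm{RV}_{-1/\theta}$ means $\lim_{q\to\infty}\frac{1-F_0(\lambda q)}{1-F_0(q)}=\lambda^{-1/\theta}$ for all $\lambda>0$; $1-F_0\in\mathrm{RV}_{-\infty}$ means $\lim_{q\to\infty}\frac{1-F_0(\lambda q)}{1-F_0(q)}=0$ for all $\lambda>1$. *)

theory Defs
  imports "HOL-Probability.Probability"
begin

definition regularly_varying :: "(real \<Rightarrow> real) \<Rightarrow> real \<Rightarrow> bool" where
  "regularly_varying f \<alpha> \<longleftrightarrow>
     (\<forall>c>0. ((\<lambda>q. f (c * q) / f q) \<longlongrightarrow> c powr \<alpha>) at_top)"

text \<open>Index of variation minus infinity.\<close>

definition rapidly_varying :: "(real \<Rightarrow> real) \<Rightarrow> bool" where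
  "rapidly_varying f \<longleftrightarrow> (\<forall>c>1. ((\<lambda>q. f (c * q) / f q) \<longlongrightarrow> 0) at_top)"

text \<open>
  Market clearing for novices, then the law of motion of
  the experts' skill CDF. Both \<open>N\<close> and \<open>I\<close> are real; only
  \<open>N - I\<close>, the mass of novices hired by an active expert, matters here.
\<close>

definition equilibrium_allocation ::
  "real \<Rightarrow> real \<Rightarrow> (real \<Rightarrow> real) \<Rightarrow> (nat \<Rightarrow> real) \<Rightarrow> (nat \<Rightarrow> real \<Rightarrow> real) \<Rightarrow> bool" where
  "equilibrium_allocation N I F0 a F \<longleftrightarrow>
     F 0 = F0 \<and>
     (\<forall>t. 1 = (N - I) * (1 - F t (a t))) \<and>
     (\<forall>t q. F (Suc t) q = (if q \<le> a t then 0 else (N - I) * (F t q - F t (a t))))"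

text \<open>
  The integral is taken against the Lebesgue--Stieltjes measure of \<open>F t\<close>.
\<close>

definition aggregate_output ::
  "real \<Rightarrow> real \<Rightarrow> real \<Rightarrow> real \<Rightarrow> (nat \<Rightarrow> real) \<Rightarrow> (nat \<Rightarrow> real \<Rightarrow> real) \<Rightarrow> nat \<Rightarrow> real" where
  "aggregate_output m h N I a F t =
     m powr I * h powr (N - I) * (LINT q:{a t..}|interval_measure (F t). q)"

end

theory Submission
  imports Defs
begin

text \<open>
  Write \<open>S = 1 - F0\<close> and \<open>r = N - I\<close>. Iterating the law of motion shows that the experts at date
  \<open>t\<close> are the initial experts above \<open>a (t - 1)\<close>, with mass scaled up by \<open>r ^ t\<close>, and that
  \<open>S (a t) = 1 / r ^ (t + 1)\<close>. So each period divides the survival function at the cutoff by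
  \<open>r\<close>, and both tail hypotheses say that this amounts asymptotically to dilating the cutoff by
  the factor \<open>L\<close> (\<open>r powr \<theta>\<close> or \<open>1\<close>). For output, let \<open>p u\<close> be the upper \<open>u\<close>-quantile of \<open>F0\<close>.
  Changing variables, \<open>Y t\<close> is proportional to the integral of \<open>p (v / r ^ (t + 1))\<close> over
  \<open>0 < v < 1\<close>; since \<open>p (u / r) / p u\<close> tends to \<open>L\<close> as \<open>u\<close> tends to \<open>0\<close>, the integrands at
  successive dates, and hence the integrals, have ratio tending to \<open>L\<close>. In particular, no appeal
  to Karamata's theorem is needed.
\<close>

section \<open>Dilation thresholds and limits of ratios\<close>

text \<open>The factor \<open>L\<close> by which the argument must be dilated to divide a tail \<open>S\<close> by \<open>r\<close>, asymptotically.\<close>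

definition dilation_threshold :: "(real \<Rightarrow> real) \<Rightarrow> real \<Rightarrow> real \<Rightarrow> bool" where
  "dilation_threshold S r L \<longleftrightarrow> L > 0 \<and>
     (\<forall>c>L. eventually (\<lambda>q. S (c * q) < S q / r) at_top) \<and>
     (\<forall>c. 0 < c \<longrightarrow> c < L \<longrightarrow> eventually (\<lambda>q. S q / r < S (c * q)) at_top)"

text \<open>The limit \<open>c powr (- 1 / \<theta>)\<close> strictly decreases in \<open>c\<close>
  and equals \<open>1 / r\<close> at \<open>c = r powr \<theta>\<close>, so off that point the ratio
  ends up strictly on one side of \<open>1 / r\<close>.\<close>

lemma regularly_varying_dilation_threshold:
  assumes "regularly_varying S (- 1 / \<theta>)" "\<theta> > 0" "r > 0" and pos: "\<And>q. S q > 0"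
  shows "dilation_threshold S r (r powr \<theta>)"
proof -
  have lim: "((\<lambda>q. S (c * q) / S q) \<longlongrightarrow> c powr (- 1 / \<theta>)) at_top" if "c > 0" for c
    using assms(1) that by (auto simp: regularly_varying_def)
  have inv: "(r powr \<theta>) powr (- 1 / \<theta>) = 1 / r"
    using assms(2,3) by (simp add: powr_powr powr_minus_divide)
  have "eventually (\<lambda>q. S (c * q) < S q / r) at_top" if "c > r powr \<theta>" for c
  proof -
    have c: "c > 0"
      using that powr_ge_zero[of r \<theta>] by linarith
    have "c powr (- 1 / \<theta>) < 1 / r"
      using powr_less_mono2_neg[of "- 1 / \<theta>" "r powr \<theta>" c] that assms(2,3) inv by simp
    from order_tendstoD(2)[OF lim[OF c] this] show ?thesis
      by eventually_elim (use pos in \<open>simp add: field_simps\<close>)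
  qed
  moreover have "eventually (\<lambda>q. S q / r < S (c * q)) at_top" if "0 < c" "c < r powr \<theta>" for c
  proof -
    have "1 / r < c powr (- 1 / \<theta>)"
      using powr_less_mono2_neg[of "- 1 / \<theta>" c "r powr \<theta>"] that assms(2,3) inv by simp
    from order_tendstoD(1)[OF lim[OF that(1)] this] show ?thesis
      by eventually_elim (use pos assms(3) in \<open>simp add: field_simps\<close>)
  qed
  ultimately show ?thesis
    using assms(3) by (auto simp: dilation_threshold_def)
qed

text \<open>Above 1 the ratio tends to 0, hence drops below \<open>1 / r\<close>. Below 1
  monotonicity suffices: \<open>S (c * q) \<ge> S q > S q / r\<close> once
  \<open>q \<ge> 0\<close>.\<close>

lemma rapidly_varying_dilation_threshold:
  assumes "rapidly_varying S" "r > 1" "antimono S" and pos: "\<And>q. S q > 0"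
  shows "dilation_threshold S r 1"
proof -
  have "eventually (\<lambda>q. S (c * q) < S q / r) at_top" if "c > 1" for c
  proof -
    have "((\<lambda>q. S (c * q) / S q) \<longlongrightarrow> 0) at_top"
      using assms(1) that by (auto simp: rapidly_varying_def)
    from order_tendstoD(2)[OF this, of "1 / r"] assms(2)
    have "eventually (\<lambda>q. S (c * q) / S q < 1 / r) at_top" by simp
    then show ?thesis
      by eventually_elim (use pos in \<open>simp add: field_simps\<close>)
  qed
  moreover have "eventually (\<lambda>q. S q / r < S (c * q)) at_top" if "0 < c" "c < 1" for c
    using eventually_ge_at_top[of 0]
  proof eventually_elim
    case (elim q)
    have "c * q \<le> 1 * q"
      using that elim by (intro mult_right_mono) auto
    then have "S q \<le> S (c * q)"
      using antimonoD[OF assms(3)] by simp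
    moreover have "S q / r < S q"
      using pos[of q] assms(2) by (simp add: field_simps)
    ultimately show ?case by simp
  qed
  ultimately show ?thesis
    by (auto simp: dilation_threshold_def)
qed

text \<open>The threshold compares \<open>S (c * x i)\<close> with
  \<open>S (x i) / r = S (y i)\<close>, and antitonicity turns this into a comparison of
  \<open>c * x i\<close> with \<open>y i\<close>. The filter is general so as to cover both cutoffs
  over time and quantiles as \<open>u\<close> tends to 0.\<close>

lemma dilation_threshold_ratio_limit:
  assumes thr: "dilation_threshold S r L" and "antimono S"
    and x: "filterlim x at_top G"
    and xy: "eventually (\<lambda>i. S (y i) = S (x i) / r) G"
  shows "((\<lambda>i. y i / x i) \<longlongrightarrow> L) G"
proof (rule order_tendstoI)
  have L: "L > 0" using thr by (simp add: dilation_threshold_def)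
  have x_pos: "eventually (\<lambda>i. x i > 0) G"
    using x filterlim_at_top_dense by blast
  have less: "u < v" if "S v < S u" for u v
    using antimonoD[OF assms(2), of v u] that by fastforce
  fix l
  {
    assume "l < L"
    \<comment> \<open>The maximum with 0 keeps \<open>c\<close> positive even for negative
      \<open>l\<close>.\<close>
    then obtain c where c: "0 < c" "l < c" "c < L"
      using L dense[of "max l 0" L] by auto
    then have "eventually (\<lambda>q. S q / r < S (c * q)) at_top"
      using thr unfolding dilation_threshold_def by blast
    then have "eventually (\<lambda>i. S (x i) / r < S (c * x i)) G"
      using x by (rule eventually_compose_filterlim)
    with xy x_pos show "eventually (\<lambda>i. l < y i / x i) G"
    proof eventually_elim
      case (elim i)
      then have "c * x i < y i" by (simp add: less)
      then have "c < y i / x i" using elim by (simp add: field_simps)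
      with c show ?case by simp
    qed
  }
  assume "L < l"
  then have "eventually (\<lambda>q. S (l * q) < S q / r) at_top"
    using thr unfolding dilation_threshold_def by blast
  then have "eventually (\<lambda>i. S (l * x i) < S (x i) / r) G"
    using x by (rule eventually_compose_filterlim)
  with xy x_pos show "eventually (\<lambda>i. y i / x i < l) G"
  proof eventually_elim
    case (elim i)
    then have "y i < l * x i" by (simp add: less)
    then show ?case using elim by (simp add: field_simps)
  qed
qed

text \<open>For small \<open>k\<close>, every \<open>k * v\<close> with \<open>v\<close> in the unit
  interval lies where \<open>p (u / r)\<close> differs from \<open>L * p u\<close> by at most
  \<open>e / 2 * p u\<close>. This bound, uniform in \<open>v\<close>, integrates directly.\<close>

lemma integral_dilation_ratio_limit:
  fixes p :: "real \<Rightarrow> real"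
  assumes "r > 1"
    and p: "filterlim p at_top (at_right 0)"
    and lim: "((\<lambda>u. p (u / r) / p u) \<longlongrightarrow> L) (at_right 0)"
    and int: "\<And>k. 0 < k \<Longrightarrow> k < 1 \<Longrightarrow> set_integrable lborel {0<..<1} (\<lambda>v. p (k * v))"
  shows "((\<lambda>k. (LINT v:{0<..<1}|lborel. p (k / r * v)) / (LINT v:{0<..<1}|lborel. p (k * v))) \<longlongrightarrow> L)
           (at_right 0)"
proof (rule tendstoI)
  fix e :: real assume e: "e > 0"
  \<comment> \<open>The bound \<open>1 \<le> p u\<close> later gives \<open>?P \<ge> 1\<close>, so
    dividing by it is safe; half of \<open>e\<close> is held back to make the final estimate
    strict.\<close>
  have "eventually (\<lambda>u. 1 \<le> p u \<and> \<bar>p (u / r) - L * p u\<bar> \<le> e / 2 * p u) (at_right 0)"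
    using p[unfolded filterlim_at_top, rule_format, of 1] tendstoD[OF lim half_gt_zero[OF e]]
  proof eventually_elim
    case (elim u)
    then have "p u > 0" by simp
    have "\<bar>p (u / r) - L * p u\<bar> = \<bar>p (u / r) / p u - L\<bar> * p u"
      using \<open>p u > 0\<close> by (simp add: abs_mult_pos' [symmetric] abs_mult field_simps flip: abs_mult_pos)
    also have "\<dots> \<le> e / 2 * p u"
      using elim \<open>p u > 0\<close> by (intro mult_right_mono) (auto simp: dist_real_def)
    finally show ?case using elim by simp
  qed
  then obtain d where d: "d > 0"
    and near: "\<And>u. 0 < u \<Longrightarrow> u < d \<Longrightarrow> 1 \<le> p u \<and> \<bar>p (u / r) - L * p u\<bar> \<le> e / 2 * p u"
    by (auto simp: eventually_at_right_field)
  show "eventually (\<lambda>k. dist ((LINT v:{0<..<1}|lborel. p (k / r * v)) / (LINT v:{0<..<1}|lborel. p (k * v))) L < e)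
          (at_right 0)"
  proof (rule eventually_mono)
    show "eventually (\<lambda>k. k \<in> {0<..<min 1 d}) (at_right 0)"
      using d by (intro eventually_at_right_real) simp
    fix k assume k: "k \<in> {0<..<min 1 d}"
    let ?A = "{0<..<1::real}"
    have kv: "0 < k * v" "k * v < d" if "v \<in> ?A" for v
      using that k mult_strict_mono[of k d v 1] by auto
    have i1: "set_integrable lborel ?A (\<lambda>v. p (k * v))"
      using k by (intro int) auto
    have i2: "set_integrable lborel ?A (\<lambda>v. p (k / r * v))"
      using k assms(1) by (intro int) (auto simp: field_simps)
    have i3: "set_integrable lborel ?A (\<lambda>v. p (k / r * v) - L * p (k * v))"
      using i1 i2 by (intro set_integral_diff set_integrable_mult_right) auto
    let ?P = "LINT v:?A|lborel. p (k * v)" and ?R = "LINT v:?A|lborel. p (k / r * v)"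
    have "(LINT v:?A|lborel. 1) \<le> ?P"
      by (rule set_integral_mono) (use i1 near kv in \<open>auto simp: set_integrable_def\<close>)
    then have P: "?P \<ge> 1" by (simp add: set_lebesgue_integral_def)
    have "\<bar>?R - L * ?P\<bar> = \<bar>LINT v:?A|lborel. p (k / r * v) - L * p (k * v)\<bar>"
      using i1 i2 by (subst set_integral_diff) (auto intro: set_integrable_mult_right)
    also have "\<dots> \<le> (LINT v:?A|lborel. \<bar>p (k / r * v) - L * p (k * v)\<bar>)"
      using set_integral_norm_bound[OF i3] by simp
    also have "\<dots> \<le> (LINT v:?A|lborel. e / 2 * p (k * v))"
    proof (rule set_integral_mono)
      show "\<bar>p (k / r * v) - L * p (k * v)\<bar> \<le> e / 2 * p (k * v)" if "v \<in> ?A" for v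
        using near[OF kv[OF that]] by simp
    qed (use i1 set_integrable_abs[OF i3] in \<open>auto intro: set_integrable_mult_right\<close>)
    also have "\<dots> = e / 2 * ?P" by simp
    also have "\<dots> < e * ?P" using e P by simp
    finally have "\<bar>?R - L * ?P\<bar> < e * ?P" .
    moreover have "?R / ?P - L = (?R - L * ?P) / ?P"
      using P by (simp add: diff_divide_distrib)
    ultimately show "dist (?R / ?P) L < e"
      using P by (simp add: dist_real_def abs_divide pos_divide_less_eq)
  qed
qed

section \<open>Quantile functions and tail integrals\<close>

context cdf_distribution
begin

text \<open>Here \<open>C\<close> is the CDF and \<open>I\<close> its quantile function, so
  \<open>I (1 - u)\<close> is the upper \<open>u\<close>-quantile.\<close>

lemma tail_quantile_less_iff:
  assumes "0 < u" "u < 1"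
  shows "x < I (1 - u) \<longleftrightarrow> u < 1 - C x"
  using pseudoinverse[of "1 - u" x] assms by linarith

text \<open>Left of the quantile \<open>C\<close> is at most \<open>1 - u\<close>, and continuity
  extends this to the quantile; the reverse bound holds because the quantile is not strictly below
  itself.\<close>

lemma tail_quantile_inverse:
  assumes atomless: "\<And>x. isCont C x" and "0 < u" "u < 1"
  shows "1 - C (I (1 - u)) = u"
proof (rule antisym)
  have "C (I (1 - u)) \<le> 1 - u"
  proof (rule tendsto_upperbound)
    show "(C \<longlongrightarrow> C (I (1 - u))) (at_left (I (1 - u)))"
      using atomless[of "I (1 - u)"] by (simp add: isCont_def filterlim_at_split)
    show "eventually (\<lambda>x. C x \<le> 1 - u) (at_left (I (1 - u)))"
      unfolding eventually_at_filter
    proof (intro always_eventually allI impI)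
      fix x
      assume "x \<in> {..<I (1 - u)}"
      then show "C x \<le> 1 - u"
        using tail_quantile_less_iff[OF assms(2,3), of x] by simp
    qed
  qed simp
  then show "u \<le> 1 - C (I (1 - u))" by simp
  show "1 - C (I (1 - u)) \<le> u"
    using tail_quantile_less_iff[OF assms(2,3), of "I (1 - u)"] by simp
qed

lemma tail_quantile_at_top:
  assumes "\<And>x. C x < 1"
  shows "filterlim (\<lambda>u. I (1 - u)) at_top (at_right 0)"
  unfolding filterlim_at_top
proof
  fix Z
  have "eventually (\<lambda>u. u \<in> {0<..<1 - C Z}) (at_right 0)"
    using assms by (intro eventually_at_right_real) simp
  then show "eventually (\<lambda>u. Z \<le> I (1 - u)) (at_right 0)"
  proof eventually_elim
    case (elim u)
    then have "0 < u" "u < 1" "u < 1 - C Z"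
      using cdf_nonneg[of Z] by auto
    then show ?case using tail_quantile_less_iff[of u Z] by simp
  qed
qed

text \<open>\<open>I\<close> pushes Lebesgue measure on the unit interval forward to
  \<open>M\<close>.\<close>

lemma set_integrable_quantile:
  assumes "integrable M (\<lambda>q. q)"
  shows "set_integrable lborel {0<..<1} I"
proof -
  have "integrable (distr (restrict_space lborel {0<..<1::real}) borel I) (\<lambda>q. q)"
    using assms by (simp only: distr_I_eq_M)
  then show ?thesis
    by (subst (asm) integrable_distr_eq)
       (auto simp: integrable_restrict_space set_integrable_def)
qed

lemma set_integrable_tail_quantile:
  assumes "integrable M (\<lambda>q. q)" "0 < s" "s < 1"
  shows "set_integrable lborel {0<..<1} (\<lambda>v. I (1 - s * v))"
proof -
  have "set_integrable lborel {1 - s<..<1} I"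
    by (rule set_integrable_subset[OF set_integrable_quantile[OF assms(1)]]) (use assms in auto)
  then have "integrable lborel (\<lambda>v. indicator {1 - s<..<1} (1 + (- s) * v) *\<^sub>R I (1 + (- s) * v))"
    unfolding set_integrable_def using assms(2) by (intro lborel_integrable_real_affine) auto
  also have "(\<lambda>v. indicator {1 - s<..<1} (1 + (- s) * v) *\<^sub>R I (1 + (- s) * v)) =
      (\<lambda>v. indicator {0<..<1} v *\<^sub>R I (1 - s * v))"
    using assms(2) by (auto simp: indicator_def fun_eq_iff zero_less_mult_iff)
  finally show ?thesis by (simp add: set_integrable_def)
qed

text \<open>The quantile transform turns the tail beyond \<open>b\<close> into the slice
  \<open>{C b<..<1}\<close> of length \<open>s\<close>, which \<open>w = 1 - s * v\<close> rescales
  to the unit interval.\<close>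

lemma tail_integral_quantile:
  assumes "isCont C b" "C b < 1"
  defines "s \<equiv> 1 - C b"
  shows "(LINT q:{b..}|M. q) = s * (LINT v:{0<..<1}|lborel. I (1 - s * v))"
proof -
  \<comment> \<open>Continuity excludes an atom at \<open>b\<close>, so the closed tail may be
    replaced by the open one, where \<open>b < I w\<close> amounts to
    \<open>C b < w\<close>.\<close>
  have null: "AE q in M. q \<noteq> b"
    using assms(1) by (intro AE_I[of _ _ "{b}"]) (auto simp: isCont_cdf emeasure_eq_measure)
  have "(LINT q:{b..}|M. q) = (LINT q|M. indicator {b<..} q * q)"
    unfolding set_lebesgue_integral_def
    by (rule integral_cong_AE) (use null in \<open>auto elim!: eventually_mono simp: indicator_def\<close>)
  also have "\<dots> = (LINT q|distr (restrict_space lborel {0<..<1::real}) borel I. indicator {b<..} q * q)"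
    by (simp only: distr_I_eq_M)
  also have "\<dots> = (LINT w|lborel. indicator {0<..<1} w *\<^sub>R (indicator {b<..} (I w) * I w))"
    by (subst integral_distr) (auto simp: integral_restrict_space)
  also have "\<dots> = (LINT w|lborel. indicator {C b<..<1} w * I w)"
  proof (rule Bochner_Integration.integral_cong)
    show "indicator {0<..<1} w *\<^sub>R (indicator {b<..} (I w) * I w) = indicator {C b<..<1} w * I w" for w
      using pseudoinverse[of w b] cdf_nonneg[of b] by (auto simp: indicator_def not_le)
  qed simp
  also have "\<dots> = s * (LINT v|lborel. indicator {C b<..<1} (1 + (- s) * v) * I (1 + (- s) * v))"
    using assms by (subst lborel_integral_real_affine[where c="- s" and t=1]) auto
  also have "(\<lambda>v. indicator {C b<..<1} (1 + (- s) * v) * I (1 + (- s) * v)) =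
      (\<lambda>v. indicator {0<..<1} v *\<^sub>R I (1 - s * v))"
  proof
    fix v
    have "C b < 1 + (- s) * v \<longleftrightarrow> s * v < s * 1" "1 + (- s) * v < 1 \<longleftrightarrow> s * 0 < s * v"
      by (simp_all add: s_def left_diff_distrib) linarith+
    moreover have "s > 0" using assms(2) by (simp add: s_def)
    ultimately have "1 + (- s) * v \<in> {C b<..<1} \<longleftrightarrow> v \<in> {0<..<1}"
      unfolding greaterThanLessThan_iff by (simp only: mult_less_cancel_left_pos conj_commute)
    then show "indicator {C b<..<1} (1 + (- s) * v) * I (1 + (- s) * v) =
        indicator {0<..<1} v *\<^sub>R I (1 - s * v)"
      by (simp add: indicator_def)
  qed
  finally show ?thesis by (simp add: set_lebesgue_integral_def)
qed

end

section \<open>Conditioning a distribution on an upper tail\<close>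

lemma interval_measure_cdf:
  assumes "real_distribution D"
  shows "interval_measure (cdf D) = D"
proof -
  interpret real_distribution D by fact
  have "cdf (interval_measure (cdf D)) = cdf D"
    by (intro cdf_interval_measure cdf_nondecreasing cdf_is_right_cont cdf_lim_at_bot)
  moreover have "real_distribution (interval_measure (cdf D))"
    by (intro real_distribution_interval_measure cdf_nondecreasing cdf_is_right_cont
        cdf_lim_at_bot cdf_lim_at_top_prob)
  ultimately show ?thesis
    using cdf_unique assms by blast
qed

lemma (in real_distribution) prob_greaterThan: "prob {b<..} = 1 - cdf M b"
proof -
  have "{b<..} = space M - {..b}" by auto
  then show ?thesis by (simp add: prob_compl cdf_def del: space_eq_univ)
qed

text \<open>A distribution is determined by its CDF. The formula uses survival functions to match
  the iterated law of motion, where \<open>(N - I) ^ Suc t\<close> is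
  \<open>1 / (1 - F0 (a t))\<close>.\<close>

lemma (in real_distribution) interval_measure_conditional_cdf:
  assumes "cdf M b < 1"
  shows "interval_measure (\<lambda>q. if q \<le> b then 0 else 1 - (1 - cdf M q) / (1 - cdf M b))
           = uniform_measure M {b<..}"
proof -
  let ?D = "uniform_measure M {b<..}"
  have p: "prob {b<..} = 1 - cdf M b" by (rule prob_greaterThan)
  have e: "emeasure M {b<..} \<noteq> 0" "emeasure M {b<..} < \<infinity>"
    using assms p by (auto simp: emeasure_eq_measure)
  interpret D: prob_space ?D
    using e by (intro prob_space_uniform_measure) auto
  have D: "real_distribution ?D"
    by standard auto
  have "cdf ?D q = (if q \<le> b then 0 else 1 - (1 - cdf M q) / (1 - cdf M b))" for q
  proof -
    have "cdf ?D q = prob ({b<..} \<inter> {..q}) / prob {b<..}"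
      unfolding cdf_def using e by (intro measure_uniform_measure) auto
    also have "{b<..} \<inter> {..q} = {b<..q}" by auto
    also have "prob {b<..q} = (if q \<le> b then 0 else cdf M q - cdf M b)"
      using cdf_diff_eq[of b q] by auto
    finally show ?thesis using p assms by (auto simp: field_simps)
  qed
  then have "cdf ?D = (\<lambda>q. if q \<le> b then 0 else 1 - (1 - cdf M q) / (1 - cdf M b))" ..
  then show ?thesis using interval_measure_cdf[OF D] by simp
qed

text \<open>The conditional measure has constant density \<open>1 / (1 - cdf M b)\<close> on
  \<open>{b<..}\<close>, which contains \<open>{b'..}\<close>.\<close>

lemma (in real_distribution) set_integral_uniform_measure_tail:
  assumes "cdf M b < 1" "b < b'"
  shows "(LINT q:{b'..}|uniform_measure M {b<..}. q) = (LINT q:{b'..}|M. q) / (1 - cdf M b)"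
proof -
  have p: "prob {b<..} = 1 - cdf M b" by (rule prob_greaterThan)
  have "uniform_measure M {b<..} = density M (\<lambda>q. ennreal (indicator {b<..} q / (1 - cdf M b)))"
    unfolding uniform_measure_def using assms p
    by (intro density_cong)
       (auto simp: emeasure_eq_measure indicator_def divide_ennreal simp flip: ennreal_1)
  then have "(LINT q:{b'..}|uniform_measure M {b<..}. q) =
      (LINT q|M. (indicator {b<..} q / (1 - cdf M b)) *\<^sub>R (indicator {b'..} q *\<^sub>R q))"
    unfolding set_lebesgue_integral_def using assms by (simp add: integral_density)
  also have "\<dots> = (LINT q|M. (indicator {b'..} q *\<^sub>R q) / (1 - cdf M b))"
    using assms by (intro Bochner_Integration.integral_cong) (auto simp: indicator_def)
  finally show ?thesis by (simp add: set_lebesgue_integral_def)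
qed

section \<open>Explicit equilibrium and its growth\<close>

lemma equilibrium_allocation_explicit:
  assumes eq: "equilibrium_allocation N I F0 a F" and r: "N - I > 1"
  shows "1 - F0 (a t) = 1 / (N - I) ^ Suc t"
    and "F (Suc t) q = (if q \<le> a t then 0 else 1 - (N - I) ^ Suc t * (1 - F0 q))"
    and "a t < a (Suc t)"
proof -
  define r where "r = N - I"
  have r1: "r > 1" using r by (simp add: r_def)
  have F0: "F 0 = F0" and clear: "\<And>t. F t (a t) = 1 - 1 / r"
    and motion: "\<And>t q. F (Suc t) q = (if q \<le> a t then 0 else r * (F t q - F t (a t)))"
    using eq r1 by (auto simp: equilibrium_allocation_def r_def[symmetric] field_simps)
  \<comment> \<open>\<open>F (Suc t)\<close> vanishes up to \<open>a t\<close>, yet market clearing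
    makes it \<open>1 - 1 / r > 0\<close> at \<open>a (Suc t)\<close>.\<close>
  have less: "a t < a (Suc t)" for t
    using clear[of "Suc t"] motion[of t "a (Suc t)"] r1 by (auto split: if_splits)
  have main: "1 - F0 (a t) = 1 / r ^ Suc t \<and>
      (\<forall>q. F (Suc t) q = (if q \<le> a t then 0 else 1 - r ^ Suc t * (1 - F0 q)))" for t
  proof (induction t)
    case 0
    show ?case using F0 clear[of 0] motion[of 0] r1 by (auto simp: field_simps)
  next
    case (Suc t)
    \<comment> \<open>As \<open>a t < a (Suc t)\<close>, the second branch of the formula applies at
      the new cutoff, and market clearing can be solved for \<open>F0 (a (Suc t))\<close>.\<close>
    have "1 - r ^ Suc t * (1 - F0 (a (Suc t))) = 1 - 1 / r"
      using Suc clear[of "Suc t"] less[of t] by simp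
    then have "1 - F0 (a (Suc t)) = 1 / r ^ Suc (Suc t)"
      using r1 by (simp add: field_simps)
    moreover have "F (Suc (Suc t)) q = (if q \<le> a (Suc t) then 0 else 1 - r ^ Suc (Suc t) * (1 - F0 q))" for q
    proof (cases "q \<le> a (Suc t)")
      case False
      then have "F (Suc t) q = 1 - r ^ Suc t * (1 - F0 q)"
        using Suc less[of t] by simp
      then show ?thesis
        using False motion[of "Suc t" q] clear[of "Suc t"] r1
        by (simp add: right_diff_distrib distrib_left)
    qed (simp add: motion)
    ultimately show ?case by blast
  qed
  show "1 - F0 (a t) = 1 / (N - I) ^ Suc t"
    and "F (Suc t) q = (if q \<le> a t then 0 else 1 - (N - I) ^ Suc t * (1 - F0 q))"
    and "a t < a (Suc t)"
    using main less by (auto simp: r_def[symmetric])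
qed

text \<open>For \<open>t = Suc k\<close> the measure of \<open>F t\<close> is \<open>M\<close>
  conditioned on \<open>{a k<..}\<close>, an event of mass \<open>1 / (N - I) ^ t\<close>; at date 0
  nothing has been conditioned yet.\<close>

lemma (in real_distribution) equilibrium_output_integral:
  assumes eq: "equilibrium_allocation N I (cdf M) a F" and r: "N - I > 1"
  shows "(LINT q:{a t..}|interval_measure (F t). q) = (N - I) ^ t * (LINT q:{a t..}|M. q)"
proof (cases t)
  case 0
  then show ?thesis
    using eq interval_measure_cdf[OF real_distribution_axioms] by (simp add: equilibrium_allocation_def)
next
  case (Suc k)
  note ex = equilibrium_allocation_explicit[OF eq r]
  have pos: "cdf M (a k) < 1"
    using ex(1)[of k] r by (smt (verit) divide_pos_pos zero_less_power)
  have "F t = (\<lambda>q. if q \<le> a k then 0 else 1 - (1 - cdf M q) / (1 - cdf M (a k)))"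
    using ex(2)[of k] unfolding ex(1)[of k] by (auto simp: Suc fun_eq_iff)
  then have "interval_measure (F t) = uniform_measure M {a k<..}"
    using interval_measure_conditional_cdf[OF pos] by simp
  then show ?thesis
    using set_integral_uniform_measure_tail[OF pos, of "a t"] ex(3)[of k] ex(1)[of k]
    by (simp add: Suc)
qed

text \<open>Both tail classes enter only through the threshold \<open>L\<close>, so one argument
  serves both. Cutoffs and quantiles each satisfy \<open>S y = S x / r\<close>, and output inherits
  the limit through its quantile integral.\<close>

lemma equilibrium_growth:
  assumes M: "real_distribution M" and int: "integrable M (\<lambda>q. q)"
    and atomless: "\<And>x. isCont (cdf M) x" and pos: "\<And>x. cdf M x < 1"
    and eq: "equilibrium_allocation N I (cdf M) a F" and r: "N - I > 1"
    and mh: "m > 0" "h > 0"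
    and thr: "dilation_threshold (\<lambda>q. 1 - cdf M q) (N - I) L"
  shows "(\<lambda>t. a (Suc t) / a t) \<longlonglongrightarrow> L"
    and "(\<lambda>t. aggregate_output m h N I a F (Suc t) / aggregate_output m h N I a F t) \<longlonglongrightarrow> L"
proof -
  interpret cdf_distribution M
    using M by (simp add: cdf_distribution_def)
  define r where "r = N - I"
  define S where "S = (\<lambda>q. 1 - cdf M q)"
  \<comment> \<open>The upper \<open>u\<close>-quantile, written out because \<open>I\<close> now
    denotes the economy's parameter.\<close>
  define p where "p = (\<lambda>u. Inf {x. 1 - u \<le> cdf M x})"
  have r1: "r > 1" using r by (simp add: r_def)
  have S: "antimono S"
    by (auto simp: S_def intro!: antimonoI cdf_nondecreasing)
  have thr: "dilation_threshold S r L" using thr by (simp add: S_def r_def)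
  have Sa: "S (a t) = (1 / r) ^ Suc t" for t
    using equilibrium_allocation_explicit(1)[OF eq r] by (simp add: S_def r_def power_one_over)
  have k0: "(\<lambda>t. (1 / r) ^ Suc t) \<longlonglongrightarrow> 0"
    using r1 by (intro LIMSEQ_Suc LIMSEQ_power_zero) auto

  \<comment> \<open>\<open>S (a t)\<close> tends to 0 while \<open>S\<close> is positive everywhere,
    so the cutoffs pass every \<open>Z\<close>.\<close>
  have "filterlim a at_top sequentially"
    unfolding filterlim_at_top
  proof
    fix Z
    have "eventually (\<lambda>t. (1 / r) ^ Suc t < S Z) sequentially"
      using pos[of Z] by (intro order_tendstoD(2)[OF k0]) (simp add: S_def)
    then show "eventually (\<lambda>t. Z \<le> a t) sequentially"
    proof eventually_elim
      case (elim t)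
      then show ?case
        using antimonoD[OF S, of "a t" Z] Sa[of t] by linarith
    qed
  qed
  then show "(\<lambda>t. a (Suc t) / a t) \<longlonglongrightarrow> L"
    by (rule dilation_threshold_ratio_limit[OF thr S]) (simp add: Sa)

  have p_top: "filterlim p at_top (at_right 0)"
    unfolding p_def by (rule tail_quantile_at_top[OF pos])
  have Sp: "S (p u) = u" if "0 < u" "u < 1" for u
    unfolding S_def p_def by (rule tail_quantile_inverse[OF atomless that])
  have "((\<lambda>u. p (u / r) / p u) \<longlongrightarrow> L) (at_right 0)"
  proof (rule dilation_threshold_ratio_limit[OF thr S p_top])
    have "eventually (\<lambda>u::real. u \<in> {0<..<1}) (at_right 0)"
      by (rule eventually_at_right_real) simp
    then show "eventually (\<lambda>u. S (p (u / r)) = S (p u) / r) (at_right 0)"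
    proof eventually_elim
      case (elim u)
      then have "0 < u / r" "u / r < 1" using r1 by (auto simp: field_simps)
      then show ?case using elim Sp by auto
    qed
  qed
  moreover have "set_integrable lborel {0<..<1} (\<lambda>v. p (k * v))" if "0 < k" "k < 1" for k
    unfolding p_def by (rule set_integrable_tail_quantile[OF int that])
  ultimately have lim: "((\<lambda>k. (LINT v:{0<..<1}|lborel. p (k / r * v)) /
      (LINT v:{0<..<1}|lborel. p (k * v))) \<longlongrightarrow> L) (at_right 0)"
    by (intro integral_dilation_ratio_limit[OF r1 p_top])
  have k: "filterlim (\<lambda>t. (1 / r) ^ Suc t) (at_right 0) sequentially"
    using k0 r1 by (auto simp: filterlim_at)
  \<comment> \<open>The factor \<open>r ^ t\<close> times the tail mass
    \<open>(1 / r) ^ Suc t\<close> leaves \<open>1 / r\<close>, the share of experts active at each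
    date; hence \<open>K\<close> is constant in time and cancels from the output ratio.\<close>
  define K where "K = m powr I * h powr (N - I) / r"
  have K: "K \<noteq> 0" using mh r1 by (simp add: K_def)
  have Y: "aggregate_output m h N I a F t = K * (LINT v:{0<..<1}|lborel. p ((1 / r) ^ Suc t * v))" for t
  proof -
    define P where "P = (LINT v:{0<..<1}|lborel. p ((1 / r) ^ Suc t * v))"
    have "(LINT q:{a t..}|M. q) = (1 / r) ^ Suc t * P"
      using tail_integral_quantile[OF atomless pos, of "a t"] Sa[of t] by (simp add: P_def p_def S_def)
    moreover have "r ^ t * (1 / r) ^ Suc t = 1 / r"
      using r1 by (simp add: power_one_over)
    ultimately have "r ^ t * (LINT q:{a t..}|M. q) = P / r"
      by (metis mult.assoc times_divide_eq_left mult_1)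
    then show ?thesis
      unfolding aggregate_output_def equilibrium_output_integral[OF eq r] K_def P_def[symmetric]
      by (simp add: r_def)
  qed
  \<comment> \<open>Advancing one date divides \<open>k\<close> by \<open>r\<close>, as in
    \<open>lim\<close>.\<close>
  have "(1 / r) ^ Suc (Suc t) = (1 / r) ^ Suc t / r" for t by simp
  then show "(\<lambda>t. aggregate_output m h N I a F (Suc t) / aggregate_output m h N I a F t) \<longlonglongrightarrow> L"
    using filterlim_compose[OF lim k] K unfolding Y by simp
qed

section \<open>Positive densities and the two tail cases\<close>

lemma positive_density_cdf:
  assumes M: "real_distribution M"
    and cont: "continuous_on {x0..} f" and f: "\<forall>q\<ge>x0. f q > 0"
    and dens: "M = density lborel (\<lambda>q. ennreal (indicator {x0..} q * f q))"
  shows "isCont (cdf M) x" and "cdf M x < 1"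
proof -
  interpret real_distribution M by fact
  have [measurable]: "(\<lambda>q. indicator {x0..} q * f q) \<in> borel_measurable borel"
    using borel_measurable_continuous_on_indicator[OF _ cont] by simp
  have null: "A \<in> null_sets M \<longleftrightarrow> A \<in> sets borel \<and> (AE q in lborel. q \<in> A \<longrightarrow> ennreal (indicator {x0..} q * f q) = 0)" for A
    by (subst dens, subst null_sets_density_iff) auto
  have "AE q in lborel. q \<in> {x} \<longrightarrow> ennreal (indicator {x0..} q * f q) = 0"
    using AE_lborel_singleton[of x] by eventually_elim simp
  then have "{x} \<in> null_sets M"
    unfolding null by simp
  then show "isCont (cdf M) x"
    by (simp add: isCont_cdf measure_def null_setsD1)
  show "cdf M x < 1"
  proof (rule ccontr)
    \<comment> \<open>The interval \<open>{?z<..<?z + 1}\<close> lies beyond \<open>x\<close> and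
      inside the support, where \<open>f\<close> is positive; a null tail beyond \<open>x\<close>
      would make it Lebesgue null.\<close>
    let ?z = "max x x0"
    assume "\<not> cdf M x < 1"
    then have "prob {x<..} = 0"
      using prob_greaterThan[of x] measure_nonneg[of M "{x<..}"] by linarith
    then have "{x<..} \<in> null_sets M"
      by (auto simp: emeasure_eq_measure)
    then have "AE q in lborel. q \<in> {x<..} \<longrightarrow> ennreal (indicator {x0..} q * f q) = 0"
      unfolding null by simp
    then have "AE q in lborel. q \<notin> {?z<..<?z + 1}"
    proof eventually_elim
      case (elim q)
      show ?case
      proof
        assume "q \<in> {?z<..<?z + 1}"
        then have "q > x" "q \<ge> x0" by auto
        then show False using elim f by (simp add: ennreal_eq_0_iff) (meson not_le)
      qed
    qed
    then have "emeasure lborel {?z<..<?z + 1} = 0"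
      by (subst (asm) AE_iff_measurable[where N="{?z<..<?z + 1}"]) auto
    then show False by (simp del: greaterThanLessThan_iff max_less_iff_conj)
  qed
qed

theorem proposition2:
  fixes \<rho> m h N I x0 :: real
    and M :: "real measure" and f F0 :: "real \<Rightarrow> real"
    and a Y :: "nat \<Rightarrow> real" and F :: "nat \<Rightarrow> real \<Rightarrow> real"
  assumes "\<rho> > 0" and "m > h" and "h > 0"
    and "0 < I" and "I < N" and "N - I > 1"
    and "x0 > \<rho> * I / (h powr N * ((m / h) powr I - 1))"
    and "real_distribution M" and "F0 = cdf M"
    and "integrable M (\<lambda>q. q)"
    and "continuous_on {x0..} f" and "\<forall>q\<ge>x0. f q > 0"
    and "M = density lborel (\<lambda>q. ennreal (indicator {x0..} q * f q))"
    and "equilibrium_allocation N I F0 a F"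
    and "Y = aggregate_output m h N I a F"
  shows "(\<forall>\<theta>\<in>{0<..<1}. regularly_varying (\<lambda>q. 1 - F0 q) (- 1 / \<theta>) \<longrightarrow>
            (\<lambda>t. a (Suc t) / a t) \<longlonglongrightarrow> (N - I) powr \<theta> \<and>
            (\<lambda>t. Y (Suc t) / Y t) \<longlonglongrightarrow> (N - I) powr \<theta>)
       \<and> (rapidly_varying (\<lambda>q. 1 - F0 q) \<longrightarrow>
            (\<lambda>t. a (Suc t) / a t) \<longlonglongrightarrow> 1 \<and>
            (\<lambda>t. Y (Suc t) / Y t) \<longlonglongrightarrow> 1)"
proof -
  interpret real_distribution M by fact
  note cdf_props = positive_density_cdf[OF assms(8,11,12,13)]
  have eq: "equilibrium_allocation N I (cdf M) a F" using assms(9,14) by simp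
  have "m > 0" using assms(2,3) by simp
  note growth = equilibrium_growth[OF assms(8,10) cdf_props eq assms(6) this assms(3)]
  have anti: "antimono (\<lambda>q. 1 - cdf M q)"
    by (auto intro!: antimonoI cdf_nondecreasing)
  have pos: "1 - cdf M q > 0" for q using cdf_props(2)[of q] by simp
  show ?thesis
    unfolding assms(9,15)
  proof (intro conjI ballI impI)
    fix \<theta> :: real
    assume \<theta>: "\<theta> \<in> {0<..<1}" "regularly_varying (\<lambda>q. 1 - cdf M q) (- 1 / \<theta>)"
    have "dilation_threshold (\<lambda>q. 1 - cdf M q) (N - I) ((N - I) powr \<theta>)"
      using \<theta> assms(6) pos by (intro regularly_varying_dilation_threshold) auto
    from growth[OF this]
    show "(\<lambda>t. a (Suc t) / a t) \<longlonglongrightarrow> (N - I) powr \<theta>"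
      and "(\<lambda>t. aggregate_output m h N I a F (Suc t) / aggregate_output m h N I a F t)
        \<longlonglongrightarrow> (N - I) powr \<theta>" .
  next
    assume "rapidly_varying (\<lambda>q. 1 - cdf M q)"
    then have "dilation_threshold (\<lambda>q. 1 - cdf M q) (N - I) 1"
      using assms(6) anti pos by (intro rapidly_varying_dilation_threshold) auto
    from growth[OF this]
    show "(\<lambda>t. a (Suc t) / a t) \<longlonglongrightarrow> 1"
      and "(\<lambda>t. aggregate_output m h N I a F (Suc t) / aggregate_output m h N I a F t)
        \<longlonglongrightarrow> 1" .
  qed
qed

end
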